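(* Let $I=[\alpha,\beta]$ with $\alpha<\beta$, let $\gamma_1,\gamma_2:I\to\mathbb{R}$ be continuous functions such that $d(x,y):=\gamma_1(x)\gamma_2(y)-\gamma_1(y)\gamma_2(x)\neq 0$ for all distinct $x,y\in I$, and suppose that the constant function $1$ belongs to $\mathrm{span}\{\gamma_1,\gamma_2\}$. Let $N\ge 0$ and $1\le n\le N+1$ be integers, let $G\in\pi_N(\gamma_1,\gamma_2)$, and let $g^{(n-1)}$ denote the multilinear (homogeneous) blossom, with $N-n+1$ arguments in $\mathbb{R}^2$, of the function $D_{\gamma_1,\gamma_2}^{\,n-1}G$. Let $\varepsilon_1,\dots,\varepsilon_n\in I$ and put $(u_i,v_i)=(\gamma_1(\varepsilon_i),\gamma_2(\varepsilon_i))$ for $i=1,\dots,n$. Then $$G_{\gamma_1,\gamma_2}[\varepsilon_1,\dots,\varepsilon_n]=\frac{(N-n+1)!}{N!}\sum_{1\le j_1\le\cdots\le j_{N-n+1}\le n} g^{(n-1)}\big((u_{j_1},v_{j_1}),\dots,(u_{j_{N-n+1}},v_{j_{N-n+1}})\big),$$ where the sum is over all weakly increasing index sequences of length $N-n+1$ in $\{1,\dots,n\}$.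
   Context: Space: $\pi_N(\gamma_1,\gamma_2)=\mathrm{span}\{\gamma_1^{N-k}\gamma_2^{k}: k=0,\dots,N\}$. Generalized derivative: $D_{\gamma_1,\gamma_2}f(x_0)=\lim_{x\to x_0}\dfrac{f(x)-f(x_0)}{d(x_0,x)}$ when the limit exists; $D^{j}_{\gamma_1,\gamma_2}$ denotes the $j$-fold iterate, $D^0_{\gamma_1,\gamma_2}f=f$. Non-polynomial divided difference: $f_{\gamma_1,\gamma_2}[x_0]=f(x_0)$ and, for distinct abscissas, $$f_{\gamma_1,\gamma_2}[x_0,\dots,x_n]=\frac{f_{\gamma_1,\gamma_2}[x_0,\dots,x_{n-2},x_n]-f_{\gamma_1,\gamma_2}[x_0,\dots,x_{n-1}]}{d(x_{n-1},x_n)}.$$ It is a symmetric function of the abscissas. For repeated abscissas (and $f$ having the needed generalized derivatives) it is defined by: if all $n+1$ abscissas equal $x_0$, the value is $D^{n}_{\gamma_1,\gamma_2}f(x_0)/n!$; otherwise reorder the abscissas so that the last two are distinct and use the recursion above. Blossom: the (non-polynomial homogeneous, multilinear) blossom with $r$ arguments of a function $F\in\pi_r(\gamma_1,\gamma_2)$ is the function $f:(\mathbb{R}^2)^r\to\mathbb{R}$ that is symmetric in its $r$ arguments, linear in each argument in $\mathbb{R}^2$ separately, and satisfies $f\big((\gamma_1(x),\gamma_2(x)),\dots,(\gamma_1(x),\gamma_2(x))\big)=F(x)$ for all $x\in I$. For $r=0$, $F$ is a constant and the blossom is that constant (and the sum in the claim has exactly one term, the empty index sequence). *)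

theory Defs
  imports "HOL-Analysis.Analysis"
begin

text \<open>Functions on the interval \<open>I\<close> are total functions \<open>real \<Rightarrow> real\<close> of which only the
  values on \<open>I\<close> matter.\<close>

definition gdet :: "(real \<Rightarrow> real) \<Rightarrow> (real \<Rightarrow> real) \<Rightarrow> real \<Rightarrow> real \<Rightarrow> real"
  where "gdet \<gamma>1 \<gamma>2 x y = \<gamma>1 x * \<gamma>2 y - \<gamma>1 y * \<gamma>2 x"

definition pi_space :: "(real \<Rightarrow> real) \<Rightarrow> (real \<Rightarrow> real) \<Rightarrow> real set \<Rightarrow> nat \<Rightarrow> (real \<Rightarrow> real) set"
  where "pi_space \<gamma>1 \<gamma>2 I N =
    {f. \<exists>c :: nat \<Rightarrow> real. \<forall>x\<in>I. f x = (\<Sum>k\<le>N. c k * (\<gamma>1 x ^ (N - k) * \<gamma>2 x ^ k))}"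

text \<open>The limit is taken inside \<open>I\<close>, hence is one-sided at the end points of \<open>I\<close>.  Where it does
  not exist, the value is unspecified.\<close>

definition gen_deriv ::
    "(real \<Rightarrow> real) \<Rightarrow> (real \<Rightarrow> real) \<Rightarrow> real set \<Rightarrow> (real \<Rightarrow> real) \<Rightarrow> real \<Rightarrow> real"
  where "gen_deriv \<gamma>1 \<gamma>2 I f x0 =
    Lim (at x0 within I) (\<lambda>x. (f x - f x0) / gdet \<gamma>1 \<gamma>2 x0 x)"

text \<open>The list \<open>xs\<close> holds the abscissas.  If they are not all equal, they are reordered as
  \<open>ys @ [a, b]\<close> with \<open>a \<noteq> b\<close>, where \<open>b\<close> is the last abscissa and \<open>a\<close> is the last one different
  from \<open>b\<close>.  Distinct abscissas thus keep their given order; see \<open>divdiff_distinct\<close>.\<close>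

function divdiff ::
    "(real \<Rightarrow> real) \<Rightarrow> (real \<Rightarrow> real) \<Rightarrow> real set \<Rightarrow> (real \<Rightarrow> real) \<Rightarrow> real list \<Rightarrow> real"
  where "divdiff \<gamma>1 \<gamma>2 I f xs =
    (let b = last xs;
         ps = filter (\<lambda>x. x \<noteq> b) xs;
         qs = filter (\<lambda>x. x = b) xs
     in if ps = [] then (gen_deriv \<gamma>1 \<gamma>2 I ^^ (length xs - 1)) f b / fact (length xs - 1)
        else let a = last ps;
                 ys = butlast qs @ butlast ps
             in (divdiff \<gamma>1 \<gamma>2 I f (ys @ [b]) - divdiff \<gamma>1 \<gamma>2 I f (ys @ [a])) / gdet \<gamma>1 \<gamma>2 a b)"
  by pat_completeness auto

lemma divdiff_length_aux:
  fixes xs :: "'a list"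
  assumes "filter (\<lambda>x. x \<noteq> last xs) xs \<noteq> []"
  shows "length (filter (\<lambda>x. x = last xs) xs) - Suc 0 + length (filter (\<lambda>x. x \<noteq> last xs) xs)
    < length xs"
proof -
  have "xs \<noteq> []" using assms by auto
  then have "last xs \<in> set (filter (\<lambda>x. x = last xs) xs)" by simp
  then have "0 < length (filter (\<lambda>x. x = last xs) xs)" by (rule length_pos_if_in_set)
  moreover have "length (filter (\<lambda>x. x = last xs) xs) + length (filter (\<lambda>x. x \<noteq> last xs) xs)
      = length xs" by (rule sum_length_filter_compl)
  ultimately show ?thesis by linarith
qed

termination divdiff
proof (relation "Wellfounded.measure (\<lambda>(\<gamma>1, \<gamma>2, I, f, xs). length xs)")
  show "wf (Wellfounded.measure (\<lambda>(\<gamma>1, \<gamma>2, I, f, xs). length xs))" by simp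
qed (use divdiff_length_aux in auto)

declare divdiff.simps [simp del]

lemma divdiff_replicate:
  "divdiff \<gamma>1 \<gamma>2 I f (replicate (Suc n) x) = (gen_deriv \<gamma>1 \<gamma>2 I ^^ n) f x / fact n"
  by (subst divdiff.simps) (simp add: Let_def last_replicate)

lemma divdiff_single: "divdiff \<gamma>1 \<gamma>2 I f [x] = f x"
  using divdiff_replicate[of \<gamma>1 \<gamma>2 I f 0 x] by simp

lemma divdiff_distinct:
  assumes "distinct (xs @ [a, b])"
  shows "divdiff \<gamma>1 \<gamma>2 I f (xs @ [a, b]) =
    (divdiff \<gamma>1 \<gamma>2 I f (xs @ [b]) - divdiff \<gamma>1 \<gamma>2 I f (xs @ [a])) / gdet \<gamma>1 \<gamma>2 a b"
proof -
  have "filter (\<lambda>x. x \<noteq> b) xs = xs" "filter (\<lambda>x. x = b) xs = []" "a \<noteq> b"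
    using assms by (auto simp: filter_empty_conv intro: filter_True)
  then show ?thesis by (subst divdiff.simps) (simp add: Let_def butlast_append)
qed

text \<open>An element of \<open>(\<real>\<^sup>2)\<^sup>r\<close> is a list of length \<open>r\<close> over \<open>real \<times> real\<close>.  Fixing the value
  outside these lists (\<open>extensional\<close>) makes the blossom unique as a HOL function.\<close>

definition is_blossom :: "(real \<Rightarrow> real) \<Rightarrow> (real \<Rightarrow> real) \<Rightarrow> real set \<Rightarrow> nat \<Rightarrow> (real \<Rightarrow> real) \<Rightarrow>
    ((real \<times> real) list \<Rightarrow> real) \<Rightarrow> bool"
  where "is_blossom \<gamma>1 \<gamma>2 I r F f \<longleftrightarrow>
    f \<in> extensional {ps. length ps = r} \<and>
    (\<forall>ps qs. length ps = r \<longrightarrow> mset ps = mset qs \<longrightarrow> f ps = f qs) \<and>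
    (\<forall>ps i. length ps = r \<longrightarrow> i < r \<longrightarrow> linear (\<lambda>p. f (ps[i := p]))) \<and>
    (\<forall>x\<in>I. f (replicate r (\<gamma>1 x, \<gamma>2 x)) = F x)"

definition blossom :: "(real \<Rightarrow> real) \<Rightarrow> (real \<Rightarrow> real) \<Rightarrow> real set \<Rightarrow> nat \<Rightarrow> (real \<Rightarrow> real) \<Rightarrow>
    (real \<times> real) list \<Rightarrow> real"
  where "blossom \<gamma>1 \<gamma>2 I r F = (THE f. is_blossom \<gamma>1 \<gamma>2 I r F f)"

end

theory Submission
  imports Defs "HOL-Computational_Algebra.Polynomial"
begin

text \<open>If \<open>a \<gamma>\<^sub>1 + b \<gamma>\<^sub>2 = 1\<close>, then \<open>(\<gamma>\<^sub>1, \<gamma>\<^sub>2) = u + t v\<close> on \<open>I\<close> for fixed vectors \<open>u\<close>, \<open>v\<close> and an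
  injective continuous \<open>t\<close> with \<open>d(x, y) = t(y) - t(x)\<close>. So everything is polynomial in \<open>t\<close>, and
  \<open>G\<close> is a linear combination of powers \<open>(1 + s t)\<^sup>N\<close>. For such a power the blossom of the
  \<open>(n-1)\<close>-st derivative is a multiple of a product of linear forms, so the right-hand side is
  \<open>s\<^sup>n\<^sup>-\<^sup>1\<close> times a complete homogeneous polynomial in the numbers \<open>1 + s t(\<epsilon>\<^sub>i)\<close>, and complete
  homogeneous polynomials satisfy the recursion that defines divided differences.\<close>

section \<open>Complete homogeneous symmetric polynomials\<close>

fun complete_homogeneous :: "nat \<Rightarrow> real list \<Rightarrow> real" where
  "complete_homogeneous 0 xs = 1"
| "complete_homogeneous (Suc r) [] = 0"
| "complete_homogeneous (Suc r) (x # xs) =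
    complete_homogeneous (Suc r) xs + x * complete_homogeneous r (x # xs)"

text \<open>This is the divided difference recursion: a difference quotient in one variable lowers
  the degree by one and keeps both variables. The induction rests on
  \<open>x p - y q = x (p - q) + (x - y) q\<close>, with \<open>p\<close> and \<open>q\<close> the
  values one degree lower.\<close>

lemma complete_homogeneous_diff:
  "complete_homogeneous (Suc r) (x # xs) - complete_homogeneous (Suc r) (y # xs) =
    (x - y) * complete_homogeneous r (x # y # xs)"
proof (induction r)
  case (Suc r)
  have "complete_homogeneous (Suc (Suc r)) (x # xs) - complete_homogeneous (Suc (Suc r)) (y # xs) =
      x * (complete_homogeneous (Suc r) (x # xs) - complete_homogeneous (Suc r) (y # xs))
      + (x - y) * complete_homogeneous (Suc r) (y # xs)"
    by (simp add: algebra_simps)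
  also have "\<dots> = (x - y) * complete_homogeneous (Suc r) (x # y # xs)"
    unfolding Suc by (simp add: algebra_simps)
  finally show ?case .
qed simp

text \<open>The difference in \<open>complete_homogeneous_diff\<close> changes sign when
  \<open>x\<close> and \<open>y\<close> are exchanged, and so does the factor \<open>x - y\<close>,
  which cancels when nonzero.\<close>

lemma complete_homogeneous_swap:
  "complete_homogeneous r (x # y # xs) = complete_homogeneous r (y # x # xs)"
proof (cases "x = y")
  case False
  have "(x - y) * complete_homogeneous r (x # y # xs) = - ((y - x) * complete_homogeneous r (y # x # xs))"
    unfolding complete_homogeneous_diff[symmetric] by simp
  then have "(x - y) * complete_homogeneous r (x # y # xs) = (x - y) * complete_homogeneous r (y # x # xs)"
    by (simp add: algebra_simps)
  then show ?thesis using False by simp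
qed simp

lemma complete_homogeneous_Cons_cong:
  assumes "\<And>r. complete_homogeneous r xs = complete_homogeneous r ys"
  shows "complete_homogeneous r (x # xs) = complete_homogeneous r (x # ys)"
  by (induction r) (simp_all add: assms)

lemma complete_homogeneous_middle:
  "complete_homogeneous r (xs @ x # ys) = complete_homogeneous r (x # xs @ ys)"
proof (induction xs arbitrary: r)
  case (Cons z zs)
  have "complete_homogeneous r (z # zs @ x # ys) = complete_homogeneous r (z # x # zs @ ys)"
    by (rule complete_homogeneous_Cons_cong) (rule Cons)
  then show ?case by (simp add: complete_homogeneous_swap[of _ z])
qed simp

lemma complete_homogeneous_mset:
  "mset xs = mset ys \<Longrightarrow> complete_homogeneous r xs = complete_homogeneous r ys"
proof (induction xs arbitrary: r ys)
  case (Cons x xs)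
  have "x \<in> set ys" using Cons.prems by (metis list.set_intros(1) set_mset_mset)
  then obtain as bs where ys: "ys = as @ x # bs" by (meson split_list)
  have "complete_homogeneous r (x # xs) = complete_homogeneous r (x # as @ bs)"
    by (rule complete_homogeneous_Cons_cong) (use Cons.prems in \<open>simp add: Cons.IH ys\<close>)
  then show ?case by (simp add: ys complete_homogeneous_middle)
qed simp

text \<open>All monomials equal \<open>z ^ r\<close>, and their number obeys Pascal's rule. This is
  the value needed when all abscissas coincide.\<close>

lemma complete_homogeneous_replicate:
  "complete_homogeneous r (replicate (Suc n) z) = of_nat (n + r choose r) * z ^ r"
proof (induction n arbitrary: r)
  case 0
  show ?case by (induction r) simp_all
next
  case (Suc n)
  show ?case
  proof (induction r)
    case (Suc r)
    have "complete_homogeneous (Suc r) (replicate (Suc (Suc n)) z) =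
        complete_homogeneous (Suc r) (replicate (Suc n) z)
        + z * complete_homogeneous r (replicate (Suc (Suc n)) z)"
      by simp
    also have "\<dots> = of_nat (Suc n + Suc r choose Suc r) * z ^ Suc r"
      unfolding Suc \<open>\<And>r. complete_homogeneous r (replicate (Suc n) z) = _ r\<close>
      by (simp add: algebra_simps)
    finally show ?case .
  qed simp
qed

text \<open>Weakly increasing index sequences enumerate the monomials. Splitting them by whether the
  least index \<open>m\<close> occurs reproduces the recursion of
  \<open>complete_homogeneous\<close>; hence an induction on \<open>r\<close> inside one on the
  number of indices.\<close>

lemma sum_sorted_lists_prod:
  fixes f :: "nat \<Rightarrow> real"
  shows "(\<Sum>js | length js = r \<and> sorted js \<and> set js \<subseteq> {m..<k}. prod_list (map f js)) =
    complete_homogeneous r (map f [m..<k])"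
proof (induction "k - m" arbitrary: m r)
  case 0
  then have "{js. length js = r \<and> sorted js \<and> set js \<subseteq> {m..<k}} = (if r = 0 then {[]} else {})"
    by auto
  then show ?case using 0 by (cases r) simp_all
next
  case (Suc d)
  then have mk: "m < k" and IH: "\<And>r. (\<Sum>js | length js = r \<and> sorted js \<and> set js \<subseteq> {Suc m..<k}.
      prod_list (map f js)) = complete_homogeneous r (map f [Suc m..<k])" by auto
  define S where "S r m = {js. length js = r \<and> sorted js \<and> set js \<subseteq> {m..<k}}" for r m
  have fin: "finite (S r m)" for r m
    by (rule finite_subset[OF _ finite_lists_length_eq[of "{m..<k}" r]]) (auto simp: S_def)
  show ?case
  proof (induction r)
    case 0
    have "{js :: nat list. length js = 0 \<and> sorted js \<and> set js \<subseteq> {m..<k}} = {[]}" by auto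
    then show ?case by simp
  next
    case (Suc r)
    \<comment> \<open>A sorted list containing \<open>m\<close> starts with it. The tail may contain
      \<open>m\<close> again, so it ranges over \<open>S r m\<close> rather than
      \<open>S r (Suc m)\<close>.\<close>
    have S: "S (Suc r) m = S (Suc r) (Suc m) \<union> (#) m ` S r m"
    proof (intro equalityI subsetI)
      fix js assume js: "js \<in> S (Suc r) m"
      then obtain i ks where [simp]: "js = i # ks" by (auto simp: S_def length_Suc_conv)
      show "js \<in> S (Suc r) (Suc m) \<union> (#) m ` S r m"
        using js by (cases "i = m") (force simp: S_def)+
    qed (use mk in \<open>force simp: S_def\<close>)
    have disj: "S (Suc r) (Suc m) \<inter> (#) m ` S r m = {}" by (auto simp: S_def)
    have "(\<Sum>js\<in>S (Suc r) m. prod_list (map f js)) =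
        (\<Sum>js\<in>S (Suc r) (Suc m). prod_list (map f js)) + (\<Sum>js\<in>(#) m ` S r m. prod_list (map f js))"
      unfolding S by (rule sum.union_disjoint) (use fin disj in auto)
    also have "(\<Sum>js\<in>(#) m ` S r m. prod_list (map f js)) = f m * (\<Sum>js\<in>S r m. prod_list (map f js))"
      by (subst sum.reindex) (auto simp: sum_distrib_left)
    also have "(\<Sum>js\<in>S r m. prod_list (map f js)) = complete_homogeneous r (map f [m..<k])"
      using Suc by (simp add: S_def)
    also have "(\<Sum>js\<in>S (Suc r) (Suc m). prod_list (map f js)) =
        complete_homogeneous (Suc r) (map f [Suc m..<k])"
      using IH by (simp add: S_def)
    finally show ?case using mk by (simp add: S_def upt_conv_Cons)
  qed
qed

section \<open>Polynomials as combinations of powers of affine functions\<close>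

text \<open>Lagrange interpolation at \<open>0, \<dots>, N\<close> writes the \<open>k\<close>-th coefficient as a functional of the
  values there; applied to \<open>(1 + X t)\<^sup>N\<close> it expresses \<open>t\<^sup>k\<close> through \<open>N\<close>-th powers.\<close>

lemma coeff_eq_sum_values:
  obtains w :: "nat \<Rightarrow> real"
  where "\<And>p. degree p \<le> N \<Longrightarrow> coeff p k = (\<Sum>i\<le>N. w i * poly p (real i))"
proof -
  define L where "L i = (\<Prod>j\<in>{..N} - {i}. [:- real j / (real i - real j), 1 / (real i - real j):])" for i
  have deg: "degree (L i) \<le> N" if "i \<le> N" for i
  proof -
    have "degree (L i) \<le> (\<Sum>j\<in>{..N} - {i}. 1)"
      unfolding L_def
      by (rule order_trans[OF degree_prod_sum_le]) (auto intro!: sum_mono)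
    then show ?thesis using that by simp
  qed
  have L: "poly (L i) (real j) = (if j = i then 1 else 0)" if "i \<le> N" "j \<le> N" for i j
  proof (cases "j = i")
    case True
    have "poly (L i) (real i) = (\<Prod>j\<in>{..N} - {i}. 1)"
      unfolding L_def poly_prod
      by (rule prod.cong) (auto simp flip: diff_divide_distrib)
    then show ?thesis using True by simp
  next
    case False
    then show ?thesis unfolding L_def poly_prod
      using that by (auto intro!: prod_zero bexI[of _ j] simp: field_simps)
  qed
  have "coeff p k = (\<Sum>i\<le>N. coeff (L i) k * poly p (real i))" if p: "degree p \<le> N" for p
  proof -
    have "p = (\<Sum>i\<le>N. smult (poly p (real i)) (L i))"
    proof (rule poly_eqI_degree[of "real ` {..N}"])
      have "degree (\<Sum>i\<le>N. smult (poly p (real i)) (L i)) \<le> N"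
        by (rule degree_sum_le) (auto intro: deg order_trans[OF degree_smult_le])
      then show "degree (\<Sum>i\<le>N. smult (poly p (real i)) (L i)) < card (real ` {..N})"
        by (simp add: card_image)
      show "degree p < card (real ` {..N})" using p by (simp add: card_image)
      fix x assume "x \<in> real ` {..N}"
      then obtain j where j: "j \<le> N" "x = real j" by auto
      then show "poly p x = poly (\<Sum>i\<le>N. smult (poly p (real i)) (L i)) x"
        by (simp add: poly_sum L if_distrib sum.delta cong: if_cong)
    qed
    then have "coeff p k = coeff (\<Sum>i\<le>N. smult (poly p (real i)) (L i)) k" by simp
    then show ?thesis by (simp add: coeff_sum mult.commute)
  qed
  then show ?thesis by (rule that)
qed

lemma poly_eq_sum_powers:
  fixes q :: "real poly"
  assumes q: "degree q \<le> N"
  obtains c where "\<And>t. poly q t = (\<Sum>i\<le>N. c i * (1 + real i * t) ^ N)"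
proof -
  have "\<exists>w. \<forall>t. t ^ k = (\<Sum>i\<le>N. w i * (1 + real i * t) ^ N)" if "k \<le> N" for k
  proof -
    obtain w where w: "\<And>p. degree p \<le> N \<Longrightarrow> coeff p k = (\<Sum>i\<le>N. w i * poly p (real i))"
      using coeff_eq_sum_values by blast
    \<comment> \<open>Here \<open>t\<close> is fixed and the slope is the polynomial variable:
      \<open>[:1, t:] ^ N\<close> has \<open>k\<close>-th coefficient
      \<open>(N choose k) * t ^ k\<close> and takes the value \<open>(1 + i t) ^ N\<close> at the
      node \<open>i\<close>.\<close>
    have "real (N choose k) * t ^ k = (\<Sum>i\<le>N. w i * (1 + real i * t) ^ N)" for t
    proof -
      have "degree ([:1, t:] ^ N) \<le> N"
        by (rule order_trans[OF degree_power_le]) simp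
      from w[OF this] show ?thesis
        using that by (simp add: coeff_linear_poly_power poly_power)
    qed
    then have "t ^ k = (\<Sum>i\<le>N. w i / real (N choose k) * (1 + real i * t) ^ N)" for t
      using that by (simp flip: sum_divide_distrib add: field_simps)
    then show ?thesis by (intro exI[of _ "\<lambda>i. w i / real (N choose k)"]) blast
  qed
  then obtain w where w: "\<And>k t. k \<le> N \<Longrightarrow> t ^ k = (\<Sum>i\<le>N. w k i * (1 + real i * t) ^ N)"
    by metis
  have "poly q t = (\<Sum>i\<le>N. (\<Sum>k\<le>N. coeff q k * w k i) * (1 + real i * t) ^ N)" for t
  proof -
    have "poly q t = (\<Sum>k\<le>N. coeff q k * t ^ k)"
      unfolding poly_altdef
      by (rule sum.mono_neutral_left) (use q in \<open>auto simp: coeff_eq_0\<close>)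
    also have "\<dots> = (\<Sum>k\<le>N. \<Sum>i\<le>N. coeff q k * w k i * (1 + real i * t) ^ N)"
      by (simp add: w sum_distrib_left mult.assoc)
    finally show ?thesis by (subst (asm) sum.swap) (simp add: sum_distrib_right)
  qed
  then show ?thesis by (rule that)
qed

section \<open>Symmetric multilinear maps and polarization\<close>

text \<open>The two algebraic clauses of \<open>is_blossom\<close>, without the diagonal and the
  extensionality. They survive differences and fixing the first argument, which drives the
  inductions on \<open>r\<close>.\<close>

definition symmetric_multilinear :: "nat \<Rightarrow> ('a::real_vector list \<Rightarrow> real) \<Rightarrow> bool" where
  "symmetric_multilinear r f \<longleftrightarrow>
    (\<forall>ps qs. length ps = r \<longrightarrow> mset ps = mset qs \<longrightarrow> f ps = f qs) \<and>
    (\<forall>ps i. length ps = r \<longrightarrow> i < r \<longrightarrow> linear (\<lambda>p. f (ps[i := p])))"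

lemma symmetric_multilinear_linear:
  assumes "symmetric_multilinear (Suc r) f" "length ps = r"
  shows "linear (\<lambda>p. f (p # ps))"
proof -
  have "linear (\<lambda>p. f ((undefined # ps)[0 := p]))"
    using assms unfolding symmetric_multilinear_def by (metis length_Cons zero_less_Suc)
  then show ?thesis by simp
qed

lemma symmetric_multilinear_Cons:
  assumes "symmetric_multilinear (Suc r) f"
  shows "symmetric_multilinear r (\<lambda>ps. f (p # ps))"
  unfolding symmetric_multilinear_def
proof (intro conjI allI impI)
  fix ps qs :: "'a list" assume "length ps = r" "mset ps = mset qs"
  then show "f (p # ps) = f (p # qs)" using assms by (simp add: symmetric_multilinear_def)
next
  fix ps :: "'a list" and i assume "length ps = r" "i < r"
  then have "linear (\<lambda>q. f ((p # ps)[Suc i := q]))"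
    using assms unfolding symmetric_multilinear_def by (metis Suc_less_eq length_Cons)
  then show "linear (\<lambda>q. f (p # ps[i := q]))" by simp
qed

lemma symmetric_multilinear_diff:
  assumes "symmetric_multilinear r f" "symmetric_multilinear r g"
  shows "symmetric_multilinear r (\<lambda>ps. f ps - g ps)"
  using assms unfolding symmetric_multilinear_def by (metis linear_compose_sub)

text \<open>The multilinear binomial theorem. One argument is split off by linearity, symmetry sorts
  the copies of \<open>u\<close> behind those of \<open>v\<close>, and Pascal's rule merges the two
  sums.\<close>

lemma symmetric_multilinear_diagonal:
  assumes "symmetric_multilinear r f"
  shows "f (replicate r (u + t *\<^sub>R v)) =
    (\<Sum>k\<le>r. real (r choose k) * t ^ k * f (replicate k v @ replicate (r - k) u))"
  using assms
proof (induction r arbitrary: f)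
  case (Suc r)
  let ?A = "\<lambda>k. f (replicate k v @ replicate (Suc r - k) u)"
  have sym: "f ps = f qs" if "length ps = Suc r" "mset ps = mset qs" for ps qs
    using Suc.prems that by (auto simp: symmetric_multilinear_def)
  have lin: "linear (\<lambda>p. f (p # replicate r (u + t *\<^sub>R v)))"
    by (rule symmetric_multilinear_linear[OF Suc.prems]) simp
  have "f (replicate (Suc r) (u + t *\<^sub>R v)) =
      f (u # replicate r (u + t *\<^sub>R v)) + t * f (v # replicate r (u + t *\<^sub>R v))"
    using linear_add[OF lin] linear_scale[OF lin] by simp
  also have "f (u # replicate r (u + t *\<^sub>R v)) =
      (\<Sum>k\<le>r. real (r choose k) * t ^ k * f (u # replicate k v @ replicate (r - k) u))"
    by (rule Suc.IH) (rule symmetric_multilinear_Cons[OF Suc.prems])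
  also have "\<dots> = (\<Sum>k\<le>r. real (r choose k) * t ^ k * ?A k)"
    by (rule sum.cong) (auto simp: Suc_diff_le intro!: sym)
  also have "\<dots> = ?A 0 + (\<Sum>k\<le>r. real (r choose Suc k) * t ^ Suc k * ?A (Suc k))"
  proof -
    \<comment> \<open>The added term \<open>k = Suc r\<close> vanishes because
      \<open>r choose Suc r = 0\<close>; the index can then be shifted to match the sum coming from
      \<open>v\<close>.\<close>
    have "(\<Sum>k\<le>r. real (r choose k) * t ^ k * ?A k) = (\<Sum>k\<le>Suc r. real (r choose k) * t ^ k * ?A k)"
      by simp
    also have "\<dots> = ?A 0 + (\<Sum>k\<le>r. real (r choose Suc k) * t ^ Suc k * ?A (Suc k))"
      by (subst sum.atMost_Suc_shift) simp
    finally show ?thesis .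
  qed
  also have "f (v # replicate r (u + t *\<^sub>R v)) =
      (\<Sum>k\<le>r. real (r choose k) * t ^ k * f (v # replicate k v @ replicate (r - k) u))"
    by (rule Suc.IH) (rule symmetric_multilinear_Cons[OF Suc.prems])
  also have "\<dots> = (\<Sum>k\<le>r. real (r choose k) * t ^ k * ?A (Suc k))"
    by simp
  finally have "f (replicate (Suc r) (u + t *\<^sub>R v)) =
      ?A 0 + (\<Sum>k\<le>r. real (Suc r choose Suc k) * t ^ Suc k * ?A (Suc k))"
    by (simp add: sum_distrib_left sum.distrib[symmetric] algebra_simps)
  also have "\<dots> = (\<Sum>k\<le>Suc r. real (Suc r choose k) * t ^ k * ?A k)"
    by (subst sum.atMost_Suc_shift) simp
  finally show ?case .
qed simp

text \<open>Expanding every argument in the spanning pair \<open>u\<close>, \<open>v\<close> leaves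
  only tuples of these two vectors, and symmetry sorts them. The induction expands the first
  argument and applies the hypothesis to both resulting maps of the remaining ones.\<close>

lemma symmetric_multilinear_eq_0I:
  assumes "symmetric_multilinear r f"
    and "\<And>p. \<exists>x y. p = x *\<^sub>R u + y *\<^sub>R v"
    and "\<And>k. k \<le> r \<Longrightarrow> f (replicate k v @ replicate (r - k) u) = 0"
    and "length ps = r"
  shows "f ps = 0"
  using assms(1,3,4)
proof (induction r arbitrary: f ps)
  case (Suc r)
  obtain p qs where ps: "ps = p # qs" "length qs = r"
    using Suc.prems(3) by (auto simp: length_Suc_conv)
  obtain x y where p: "p = x *\<^sub>R u + y *\<^sub>R v" using assms(2) by blast
  have lin: "linear (\<lambda>p. f (p # qs))"
    by (rule symmetric_multilinear_linear[OF Suc.prems(1) ps(2)])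
  have sym: "f ps = f qs" if "length ps = Suc r" "mset ps = mset qs" for ps qs
    using Suc.prems that by (auto simp: symmetric_multilinear_def)
  have "f (v # qs) = 0"
  proof (rule Suc.IH[OF symmetric_multilinear_Cons[OF Suc.prems(1)] _ ps(2)])
    fix k assume "k \<le> r"
    then show "f (v # replicate k v @ replicate (r - k) u) = 0"
      using Suc.prems(2)[of "Suc k"] by simp
  qed
  moreover have "f (u # qs) = 0"
  proof (rule Suc.IH[OF symmetric_multilinear_Cons[OF Suc.prems(1)] _ ps(2)])
    fix k assume k: "k \<le> r"
    have "f (u # replicate k v @ replicate (r - k) u) = f (replicate k v @ replicate (Suc r - k) u)"
      using k by (intro sym) (simp_all add: Suc_diff_le)
    then show "f (u # replicate k v @ replicate (r - k) u) = 0"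
      using Suc.prems(2)[of k] k by simp
  qed
  ultimately show ?case
    using linear_add[OF lin] linear_scale[OF lin] by (simp add: ps p)
qed simp

text \<open>Along the line \<open>u + t v\<close> the diagonal of the difference is a polynomial in
  \<open>t\<close> with infinitely many roots. Its coefficients, which are binomial multiples of the
  values at sorted tuples of \<open>v\<close> and \<open>u\<close>, therefore vanish.\<close>

lemma symmetric_multilinear_unique:
  assumes "symmetric_multilinear r f" "symmetric_multilinear r g"
    and "\<And>p. \<exists>x y. p = x *\<^sub>R u + y *\<^sub>R v"
    and "infinite T"
    and "\<And>t. t \<in> T \<Longrightarrow> f (replicate r (u + t *\<^sub>R v)) = g (replicate r (u + t *\<^sub>R v))"
    and "length ps = r"
  shows "f ps = g ps"
proof -
  let ?h = "\<lambda>ps. f ps - g ps"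
  let ?c = "\<lambda>k. real (r choose k) * ?h (replicate k v @ replicate (r - k) u)"
  have h: "symmetric_multilinear r ?h"
    using assms(1,2) by (rule symmetric_multilinear_diff)
  have "T \<subseteq> {t. (\<Sum>k\<le>r. ?c k * t ^ k) = 0}"
  proof (intro subsetI CollectI)
    fix t assume "t \<in> T"
    then show "(\<Sum>k\<le>r. ?c k * t ^ k) = 0"
      using symmetric_multilinear_diagonal[OF h, of u t v] assms(5)[of t]
      by (simp add: mult_ac)
  qed
  then have "\<not> (\<exists>k\<le>r. ?c k \<noteq> 0)"
    using assms(4) by (subst polyfun_finite_roots[symmetric]) (rule infinite_super)
  then have "?h (replicate k v @ replicate (r - k) u) = 0" if "k \<le> r" for k
    using that by fastforce
  from symmetric_multilinear_eq_0I[OF h assms(3) this assms(6)] show ?thesis by simp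
qed

lemma linear_prod_list_update:
  assumes "linear L" "i < length ps"
  shows "linear (\<lambda>p. prod_list (map L (ps[i := p])) :: real)"
proof -
  have "(\<lambda>p. prod_list (map L (ps[i := p]))) =
      (\<lambda>p. (prod_list (map L (take i ps)) * prod_list (map L (drop (Suc i) ps))) *\<^sub>R L p)"
    using assms(2) by (simp add: upd_conv_take_nth_drop fun_eq_iff)
  then show ?thesis using linear_compose_scale_right[OF assms(1)] by simp
qed

text \<open>On the diagonal this map is a sum of multiples of \<open>r\<close>-th powers of linear
  forms, so the lemma supplies the blossoms of such sums.\<close>

lemma symmetric_multilinear_sum_prod_list:
  fixes L :: "'i \<Rightarrow> 'a::real_vector \<Rightarrow> real"
  assumes "\<And>i. i \<in> A \<Longrightarrow> linear (L i)"
  shows "symmetric_multilinear r (\<lambda>ps. \<Sum>i\<in>A. c i * prod_list (map (L i) ps))"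
  unfolding symmetric_multilinear_def
proof (intro conjI allI impI)
  fix ps qs :: "'a list" assume "mset ps = mset qs"
  then have "prod_list (map (L i) ps) = prod_list (map (L i) qs)" for i
    by (metis mset_map prod_mset_prod_list)
  then show "(\<Sum>i\<in>A. c i * prod_list (map (L i) ps)) = (\<Sum>i\<in>A. c i * prod_list (map (L i) qs))"
    by simp
next
  fix ps :: "'a list" and j assume j: "length ps = r" "j < r"
  have "linear (\<lambda>p. c i *\<^sub>R prod_list (map (L i) (ps[j := p])))" if "i \<in> A" for i
    by (intro linear_compose_scale_right linear_prod_list_update) (use assms that j in auto)
  then have "linear (\<lambda>p. \<Sum>i\<in>A. c i *\<^sub>R prod_list (map (L i) (ps[j := p])))"
    by (intro linear_compose_sum) blast
  then show "linear (\<lambda>p. \<Sum>i\<in>A. c i * prod_list (map (L i) (ps[j := p])))" by simp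
qed

section \<open>Generalized derivatives and divided differences in an affine coordinate\<close>

locale affine_chart =
  fixes \<gamma>1 \<gamma>2 :: "real \<Rightarrow> real" and I :: "real set" and t :: "real \<Rightarrow> real"
  assumes gdet_eq: "\<And>x y. x \<in> I \<Longrightarrow> y \<in> I \<Longrightarrow> gdet \<gamma>1 \<gamma>2 x y = t y - t x"
    and inj: "inj_on t I"
    and cont: "continuous_on I t"
    and limpt: "\<And>x. x \<in> I \<Longrightarrow> x islimpt I"
begin

text \<open>With \<open>gdet\<close> a difference of coordinates, the generalized difference
  quotient is the ordinary one of \<open>\<phi>\<close> after the substitution
  \<open>\<tau> = t x\<close>. Continuity and injectivity of \<open>t\<close> justify the
  substitution in the limit.\<close>

lemma gen_deriv_compose:
  assumes x0: "x0 \<in> I" and F: "\<And>x. x \<in> I \<Longrightarrow> F x = \<phi> (t x)"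
    and D: "(\<phi> has_real_derivative D) (at (t x0))"
  shows "gen_deriv \<gamma>1 \<gamma>2 I F x0 = D"
proof -
  have "((\<lambda>\<tau>. (\<phi> \<tau> - \<phi> (t x0)) / (\<tau> - t x0)) \<longlongrightarrow> D) (at (t x0))"
    using D by (simp add: has_field_derivative_iff)
  moreover have "filterlim t (at (t x0)) (at x0 within I)"
  proof (subst filterlim_at, intro conjI)
    show "\<forall>\<^sub>F x in at x0 within I. t x \<in> UNIV \<and> t x \<noteq> t x0"
      using x0 inj by (auto simp: eventually_at_filter inj_on_eq_iff)
    show "(t \<longlongrightarrow> t x0) (at x0 within I)"
      using cont x0 by (simp add: continuous_on_def)
  qed
  ultimately have "((\<lambda>x. (\<phi> (t x) - \<phi> (t x0)) / (t x - t x0)) \<longlongrightarrow> D) (at x0 within I)"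
    by (rule filterlim_compose)
  then have "((\<lambda>x. (F x - F x0) / gdet \<gamma>1 \<gamma>2 x0 x) \<longlongrightarrow> D) (at x0 within I)"
    by (rule Lim_transform_eventually)
      (use x0 in \<open>auto simp: eventually_at_filter F gdet_eq\<close>)
  \<comment> \<open>Since \<open>x0\<close> is a limit point of \<open>I\<close>, the filter is
    nontrivial and \<open>Lim\<close> is the actual limit, not an unspecified value.\<close>
  then show ?thesis
    unfolding gen_deriv_def using limpt[OF x0] by (intro tendsto_Lim) (auto simp: trivial_limit_within)
qed

text \<open>Each derivative brings down the exponent and one slope \<open>s i\<close>; the exponents
  brought down multiply to \<open>fact N / fact (N - m)\<close>.\<close>

lemma gen_deriv_funpow_sum_powers:
  assumes F: "\<And>x. x \<in> I \<Longrightarrow> F x = (\<Sum>i\<in>A. c i * (1 + s i * t x) ^ N)"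
    and "m \<le> N" "x \<in> I"
  shows "(gen_deriv \<gamma>1 \<gamma>2 I ^^ m) F x =
    (\<Sum>i\<in>A. c i * (fact N / fact (N - m)) * s i ^ m * (1 + s i * t x) ^ (N - m))"
  using assms(2,3)
proof (induction m arbitrary: x)
  case (Suc m)
  define r where "r = N - Suc m"
  have r: "N - m = Suc r" using Suc.prems by (simp add: r_def)
  let ?\<phi> = "\<lambda>\<tau>. \<Sum>i\<in>A. c i * (fact N / fact (Suc r)) * s i ^ m * (1 + s i * \<tau>) ^ Suc r"
  have "gen_deriv \<gamma>1 \<gamma>2 I ((gen_deriv \<gamma>1 \<gamma>2 I ^^ m) F) x =
      (\<Sum>i\<in>A. c i * (fact N / fact (Suc r)) * s i ^ m * (real (Suc r) * (1 + s i * t x) ^ r * s i))"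
  proof (rule gen_deriv_compose[of _ _ ?\<phi>])
    show "(gen_deriv \<gamma>1 \<gamma>2 I ^^ m) F y = ?\<phi> (t y)" if "y \<in> I" for y
      using Suc.IH[OF _ that] Suc.prems by (simp add: r)
    have "((\<lambda>\<tau>. (1 + s i * \<tau>) ^ Suc r) has_real_derivative real (Suc r) * (1 + s i * t x) ^ r * s i)
        (at (t x))" for i
    proof -
      have "((\<lambda>\<tau>. 1 + s i * \<tau>) has_real_derivative s i) (at (t x))"
        by (auto intro!: derivative_eq_intros)
      from DERIV_power_Suc[OF this, of r] show ?thesis by (simp add: mult_ac)
    qed
    then show "(?\<phi> has_real_derivative (\<Sum>i\<in>A. c i * (fact N / fact (Suc r)) * s i ^ m *
        (real (Suc r) * (1 + s i * t x) ^ r * s i))) (at (t x))"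
      by (intro DERIV_sum DERIV_cmult)
  qed (use Suc.prems in simp)
  also have "\<dots> = (\<Sum>i\<in>A. c i * (fact N / fact r) * s i ^ Suc m * (1 + s i * t x) ^ r)"
    by (rule sum.cong) (simp_all add: field_simps del: of_nat_Suc)
  finally show ?case by (simp add: r_def)
qed (simp add: F)

text \<open>Strong induction along the recursion of \<open>divdiff\<close>: equal abscissas reduce
  to iterated derivatives, the others to \<open>complete_homogeneous_diff\<close>.\<close>

lemma divdiff_sum_powers:
  assumes F: "\<And>x. x \<in> I \<Longrightarrow> F x = (\<Sum>i\<in>A. c i * (1 + s i * t x) ^ N)"
    and "xs \<noteq> []" "set xs \<subseteq> I" "length xs \<le> N + 1"
  shows "divdiff \<gamma>1 \<gamma>2 I F xs =
    (\<Sum>i\<in>A. c i * s i ^ (length xs - 1) *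
      complete_homogeneous (N + 1 - length xs) (map (\<lambda>x. 1 + s i * t x) xs))"
  using assms(2-4)
proof (induction "length xs" arbitrary: xs rule: less_induct)
  case less
  define b where "b = last xs"
  define ps where "ps = filter (\<lambda>x. x \<noteq> b) xs"
  define qs where "qs = filter (\<lambda>x. x = b) xs"
  have "b \<in> set xs" using less.prems by (simp add: b_def)
  show ?case
  proof (cases "ps = []")
    case True
    define m where "m = length xs - 1"
    have "\<forall>x\<in>set xs. x = b" using True by (auto simp: ps_def filter_empty_conv)
    then have "xs = replicate (length xs) b" by (simp add: replicate_length_same)
    then have xs: "xs = replicate (Suc m) b" using less.prems by (simp add: m_def)
    have m: "m \<le> N" using less.prems by (simp add: m_def)
    \<comment> \<open>Dividing by \<open>fact m\<close> turns the falling factorial into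
      \<open>N choose (N - m)\<close>, the number of monomials in
      \<open>complete_homogeneous_replicate\<close>.\<close>
    have "c i * (fact N / fact (N - m)) * s i ^ m * (1 + s i * t b) ^ (N - m) / fact m =
        c i * s i ^ m * (real (m + (N - m) choose (N - m)) * (1 + s i * t b) ^ (N - m))" for i
      using m binomial_fact[of "N - m" N, where 'a = real] by simp
    then have "divdiff \<gamma>1 \<gamma>2 I F (replicate (Suc m) b) = (\<Sum>i\<in>A. c i * s i ^ m *
        complete_homogeneous (N - m) (replicate (Suc m) (1 + s i * t b)))"
      unfolding divdiff_replicate complete_homogeneous_replicate
      using m less.prems \<open>b \<in> set xs\<close>
      by (subst gen_deriv_funpow_sum_powers[OF F]) (auto simp: sum_divide_distrib)
    then show ?thesis by (simp add: xs del: replicate_Suc)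
  next
    case False
    define a where "a = last ps"
    define ys where "ys = butlast qs @ butlast ps"
    have "a \<in> set ps" using False by (simp add: a_def)
    then have a: "a \<in> I" "a \<noteq> b" "b \<in> I"
      using less.prems \<open>b \<in> set xs\<close> by (auto simp: ps_def)
    have "b \<in> set qs" using \<open>b \<in> set xs\<close> by (simp add: qs_def)
    then have "qs \<noteq> []" by auto
    have "last qs \<in> set qs" using \<open>qs \<noteq> []\<close> by simp
    then have "last qs = b" by (simp add: qs_def)
    have snoc: "mset zs = add_mset (last zs) (mset (butlast zs))" if "zs \<noteq> []" for zs :: "real list"
      by (subst append_butlast_last_id[OF that, symmetric]) (simp del: append_butlast_last_id)
    have "mset qs = add_mset b (mset (butlast qs))"
      using snoc[OF \<open>qs \<noteq> []\<close>] \<open>last qs = b\<close> by simp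
    moreover have "mset ps = add_mset a (mset (butlast ps))"
      using snoc[OF False] by (simp add: a_def)
    moreover have "mset xs = mset qs + mset ps"
      by (simp add: qs_def ps_def)
    \<comment> \<open>Each \<open>butlast\<close> removes exactly one copy, of \<open>b\<close> from
      \<open>qs\<close> and of \<open>a\<close> from \<open>ps\<close>, so \<open>a # b # ys\<close>
      is a reordering of \<open>xs\<close>.\<close>
    ultimately have mset: "mset xs = mset (a # b # ys)" by (simp add: ys_def)
    have len: "length xs = Suc (Suc (length ys))" using mset_eq_length[OF mset] by simp
    have "set xs = set (a # b # ys)" using mset by (rule mset_eq_setD)
    then have ys: "set ys \<subseteq> I" using less.prems by auto
    define r where "r = N + 1 - length xs"
    have r: "N - length ys = Suc r" using less.prems len by (simp add: r_def)
    let ?h = "\<lambda>r i xs. complete_homogeneous r (map (\<lambda>x. 1 + s i * t x) xs)"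
    have IH: "divdiff \<gamma>1 \<gamma>2 I F (ys @ [z]) =
        (\<Sum>i\<in>A. c i * s i ^ length ys * ?h (Suc r) i (z # ys))" if "z \<in> I" for z
    proof -
      have "divdiff \<gamma>1 \<gamma>2 I F (ys @ [z]) = (\<Sum>i\<in>A. c i * s i ^ length ys * ?h (Suc r) i (ys @ [z]))"
        using less.hyps[of "ys @ [z]"] less.prems that ys len by (simp add: r)
      moreover have "?h (Suc r) i (ys @ [z]) = ?h (Suc r) i (z # ys)" for i
        by (rule complete_homogeneous_mset) simp
      ultimately show ?thesis by simp
    qed
    have "divdiff \<gamma>1 \<gamma>2 I F xs =
        (divdiff \<gamma>1 \<gamma>2 I F (ys @ [b]) - divdiff \<gamma>1 \<gamma>2 I F (ys @ [a])) / gdet \<gamma>1 \<gamma>2 a b"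
      using False by (subst divdiff.simps) (simp add: Let_def a_def b_def ps_def qs_def ys_def)
    also have "\<dots> = (\<Sum>i\<in>A. c i * s i ^ length ys * (?h (Suc r) i (b # ys) - ?h (Suc r) i (a # ys)))
        / (t b - t a)"
      by (simp add: IH a gdet_eq right_diff_distrib sum_subtractf del: complete_homogeneous.simps)
    also have "\<dots> = (\<Sum>i\<in>A. c i * s i ^ Suc (length ys) * ?h r i xs)"
    proof -
      \<comment> \<open>The two differing variables are \<open>1 + s i * t b\<close> and
        \<open>1 + s i * t a\<close>. Their difference yields one more factor \<open>s i\<close> and
        the factor that cancels against \<open>gdet\<close>.\<close>
      have "?h (Suc r) i (b # ys) - ?h (Suc r) i (a # ys) = s i * (t b - t a) * ?h r i xs" for i
      proof -
        have "?h r i xs = ?h r i (b # a # ys)"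
          by (rule complete_homogeneous_mset) (simp add: mset)
        then show ?thesis
          by (simp add: complete_homogeneous_diff right_diff_distrib
              del: complete_homogeneous.simps)
      qed
      moreover have "t b - t a \<noteq> 0" using inj a by (simp add: inj_on_eq_iff)
      ultimately show ?thesis
        unfolding sum_divide_distrib by (intro sum.cong) simp_all
    qed
    finally show ?thesis by (simp add: len r_def)
  qed
qed

end

section \<open>Identification of the blossom and the final formula\<close>

text \<open>The curve meets the line \<open>u + t v\<close> in infinitely many points, so the
  diagonal values determine the blossom; restricting \<open>f\<close> to lists of length
  \<open>r\<close> gives a candidate for the definite description.\<close>

lemma blossom_eqI:
  assumes "infinite (t ` I)"
    and P: "\<And>x. x \<in> I \<Longrightarrow> (\<gamma>1 x, \<gamma>2 x) = u + t x *\<^sub>R v"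
    and span: "\<And>p. \<exists>x y. p = x *\<^sub>R u + y *\<^sub>R v"
    and f: "symmetric_multilinear r f"
    and diag: "\<And>x. x \<in> I \<Longrightarrow> f (replicate r (\<gamma>1 x, \<gamma>2 x)) = F x"
    and ps: "length ps = r"
  shows "blossom \<gamma>1 \<gamma>2 I r F ps = f ps"
proof -
  let ?f = "restrict f {ps. length ps = r}"
  have f': "is_blossom \<gamma>1 \<gamma>2 I r F ?f"
    unfolding is_blossom_def
  proof (intro conjI allI impI ballI)
    fix ps qs :: "(real \<times> real) list" assume "length ps = r" "mset ps = mset qs"
    moreover from this have "length qs = r" using mset_eq_length by fastforce
    moreover from calculation have "f ps = f qs"
      using f unfolding symmetric_multilinear_def by blast
    ultimately show "?f ps = ?f qs" by simp
  next
    fix ps :: "(real \<times> real) list" and i assume "length ps = r" "i < r"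
    moreover from this have "linear (\<lambda>p. f (ps[i := p]))"
      using f unfolding symmetric_multilinear_def by blast
    ultimately show "linear (\<lambda>p. ?f (ps[i := p]))" by simp
  qed (simp_all add: diag)
  have "blossom \<gamma>1 \<gamma>2 I r F = ?f"
    unfolding blossom_def
  proof (rule the_equality[of "is_blossom \<gamma>1 \<gamma>2 I r F"])
    fix g assume g: "is_blossom \<gamma>1 \<gamma>2 I r F g"
    show "g = ?f"
    proof (rule extensionalityI[of _ "{ps. length ps = r}"])
      fix qs :: "(real \<times> real) list" assume "qs \<in> {ps. length ps = r}"
      then have qs: "length qs = r" by simp
      have "symmetric_multilinear r g"
        using g unfolding is_blossom_def symmetric_multilinear_def by blast
      moreover have "g (replicate r (u + \<sigma> *\<^sub>R v)) = f (replicate r (u + \<sigma> *\<^sub>R v))"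
        if \<sigma>: "\<sigma> \<in> t ` I" for \<sigma>
      proof -
        obtain x where x: "x \<in> I" "\<sigma> = t x" using \<sigma> by blast
        have "g (replicate r (\<gamma>1 x, \<gamma>2 x)) = F x"
          using g x unfolding is_blossom_def by blast
        then show ?thesis using diag[OF x(1)] by (simp add: x(2) P[OF x(1), symmetric])
      qed
      ultimately have "g qs = f qs"
        by (rule symmetric_multilinear_unique[OF _ f span assms(1) _ qs])
      then show "g qs = ?f qs" using qs by simp
    next
      show "g \<in> extensional {ps. length ps = r}"
        using g unfolding is_blossom_def by blast
    qed simp
  qed (rule f')
  then show ?thesis by (simp add: ps)
qed

theorem theorem4p10:
  fixes \<alpha> \<beta> :: real and \<gamma>1 \<gamma>2 G :: "real \<Rightarrow> real" and N n :: nat and \<epsilon> :: "nat \<Rightarrow> real"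
    and I :: "real set"
  defines "I \<equiv> {\<alpha>..\<beta>}"
  assumes "\<alpha> < \<beta>"
    and "continuous_on I \<gamma>1" and "continuous_on I \<gamma>2"
    and "\<And>x y. x \<in> I \<Longrightarrow> y \<in> I \<Longrightarrow> x \<noteq> y \<Longrightarrow> gdet \<gamma>1 \<gamma>2 x y \<noteq> 0"
    and "\<exists>a b :: real. \<forall>x\<in>I. 1 = a * \<gamma>1 x + b * \<gamma>2 x"
    and "1 \<le> n" and "n \<le> N + 1"
    and "G \<in> pi_space \<gamma>1 \<gamma>2 I N"
    and "\<And>i. i \<in> {1..n} \<Longrightarrow> \<epsilon> i \<in> I"
  shows "divdiff \<gamma>1 \<gamma>2 I G (map \<epsilon> [1..<n + 1]) =
    fact (N + 1 - n) / fact N *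
    (\<Sum>js | length js = N + 1 - n \<and> sorted js \<and> set js \<subseteq> {1..n}.
       blossom \<gamma>1 \<gamma>2 I (N + 1 - n) ((gen_deriv \<gamma>1 \<gamma>2 I ^^ (n - 1)) G)
         (map (\<lambda>j. (\<gamma>1 (\<epsilon> j), \<gamma>2 (\<epsilon> j))) js))"
proof -
  obtain a b :: real where ab: "\<And>x. x \<in> I \<Longrightarrow> a * \<gamma>1 x + b * \<gamma>2 x = 1"
    using assms(6) by metis
  define D where "D = a\<^sup>2 + b\<^sup>2"
  have "\<alpha> \<in> I" using \<open>\<alpha> < \<beta>\<close> by (simp add: I_def)
  then have "a \<noteq> 0 \<or> b \<noteq> 0" using ab by force
  then have D: "D \<noteq> 0" by (simp add: D_def sum_power2_eq_zero_iff)
  \<comment> \<open>The vectors \<open>u\<close> and \<open>v\<close> below form an orthogonal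
    basis: \<open>u\<close> lies on the line \<open>a x + b y = 1\<close>, which contains the curve,
    and \<open>v\<close> is its direction. The coordinate along \<open>v\<close> is
    \<open>\<tau>\<close>.\<close>
  define \<tau> where "\<tau> p = (a * snd p - b * fst p) / D" for p :: "real \<times> real"
  define t where "t x = \<tau> (\<gamma>1 x, \<gamma>2 x)" for x
  define u v where "u = (a / D, b / D)" and "v = (- b, a)"
  have decomp: "p = (a * fst p + b * snd p) *\<^sub>R u + \<tau> p *\<^sub>R v" for p
  proof -
    have "fst p * D = (a * fst p + b * snd p) * a - (a * snd p - b * fst p) * b"
      "snd p * D = (a * fst p + b * snd p) * b + (a * snd p - b * fst p) * a"
      by (simp_all add: D_def algebra_simps power2_eq_square)
    then show ?thesis
      using D by (simp add: prod_eq_iff u_def v_def \<tau>_def field_simps)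
  qed
  have P: "(\<gamma>1 x, \<gamma>2 x) = u + t x *\<^sub>R v" if "x \<in> I" for x
    using decomp[of "(\<gamma>1 x, \<gamma>2 x)"] ab[OF that] by (simp add: t_def)
  have span: "\<exists>x y. p = x *\<^sub>R u + y *\<^sub>R v" for p
    using decomp by blast
  have \<gamma>: "\<gamma>1 x = a / D - b * t x" "\<gamma>2 x = b / D + a * t x" if "x \<in> I" for x
    using P[OF that] by (simp_all add: u_def v_def)
  \<comment> \<open>The determinant of \<open>u + t x v\<close> and \<open>u + t y v\<close> is
    \<open>t y - t x\<close> times that of \<open>u\<close> and \<open>v\<close>; the scaling of
    \<open>u\<close> by \<open>1 / D\<close> makes the latter 1.\<close>
  have gdet_t: "gdet \<gamma>1 \<gamma>2 x y = t y - t x" if "x \<in> I" "y \<in> I" for x y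
  proof -
    have "gdet \<gamma>1 \<gamma>2 x y = (a\<^sup>2 + b\<^sup>2) / D * (t y - t x)"
      using D that by (simp add: gdet_def \<gamma> field_simps power2_eq_square)
    moreover have "(a\<^sup>2 + b\<^sup>2) / D = 1" using D by (simp add: D_def)
    ultimately show ?thesis by simp
  qed
  interpret affine_chart \<gamma>1 \<gamma>2 I t
  proof
    show "inj_on t I"
    proof (rule inj_onI)
      fix x y assume "x \<in> I" "y \<in> I" "t x = t y"
      then show "x = y" using assms(5)[of x y] gdet_t[of x y] by auto
    qed
    show "continuous_on I t"
      unfolding t_def \<tau>_def using assms(3,4) D by (auto intro!: continuous_intros)
    show "x islimpt I" if "x \<in> I" for x
      using that \<open>\<alpha> < \<beta>\<close> by (simp add: I_def islimpt_Icc)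
  qed (rule gdet_t)
  have inf: "infinite (t ` I)"
    using \<open>\<alpha> < \<beta>\<close> inj by (simp add: finite_image_iff I_def infinite_Icc)
  obtain q where q: "degree q \<le> N" "\<And>x. x \<in> I \<Longrightarrow> G x = poly q (t x)"
  proof -
    obtain c where c: "\<And>x. x \<in> I \<Longrightarrow> G x = (\<Sum>k\<le>N. c k * (\<gamma>1 x ^ (N - k) * \<gamma>2 x ^ k))"
      using assms(9) by (auto simp: pi_space_def)
    let ?q = "\<Sum>k\<le>N. smult (c k) ([:a / D, - b:] ^ (N - k) * [:b / D, a:] ^ k)"
    have "degree ([:a / D, - b:] ^ (N - k) * [:b / D, a:] ^ k) \<le> N" if "k \<le> N" for k
    proof -
      have "degree ([:a / D, - b:] ^ (N - k)) \<le> N - k" "degree ([:b / D, a:] ^ k) \<le> k"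
        by (rule order_trans[OF degree_power_le]; simp)+
      then show ?thesis
        using that degree_mult_le[of "[:a / D, - b:] ^ (N - k)" "[:b / D, a:] ^ k"] by linarith
    qed
    then have "degree ?q \<le> N"
      by (intro degree_sum_le) (auto intro: order_trans[OF degree_smult_le])
    moreover have "G x = poly ?q (t x)" if "x \<in> I" for x
      using that by (simp add: c \<gamma> poly_sum poly_power mult.commute)
    ultimately show ?thesis by (rule that)
  qed
  obtain c where c: "\<And>\<tau>. poly q \<tau> = (\<Sum>i\<le>N. c i * (1 + real i * \<tau>) ^ N)"
    using poly_eq_sum_powers[OF q(1)] by blast
  have G: "G x = (\<Sum>i\<le>N. c i * (1 + real i * t x) ^ N)" if "x \<in> I" for x
    using q(2)[OF that] c by simp
  define r where "r = N + 1 - n"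
  have r: "N - (n - 1) = r" using assms(7,8) by (simp add: r_def)
  \<comment> \<open>Homogenization of \<open>1 + i t\<close>: the constant 1 is replaced by the form
    \<open>a x + b y\<close>, which equals 1 on the curve.\<close>
  define L where "L i p = (a * fst p + b * snd p) + real i * \<tau> p" for i and p :: "real \<times> real"
  have L: "L i (\<gamma>1 x, \<gamma>2 x) = 1 + real i * t x" if "x \<in> I" for i x
    using ab[OF that] by (simp add: L_def t_def)
  have lin: "linear (L i)" for i
    by (rule linearI) (simp_all add: L_def \<tau>_def add_divide_distrib diff_divide_distrib algebra_simps)
  \<comment> \<open>The coefficients after \<open>n - 1\<close> derivatives. For
    \<open>n = 1\<close> the term \<open>i = 0\<close> survives because
    \<open>0 ^ 0 = 1\<close>.\<close>
  define C where "C i = c i * (fact N / fact r) * real i ^ (n - 1)" for i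
  have blossom: "blossom \<gamma>1 \<gamma>2 I r ((gen_deriv \<gamma>1 \<gamma>2 I ^^ (n - 1)) G) ps =
      (\<Sum>i\<le>N. C i * prod_list (map (L i) ps))" if "length ps = r" for ps
  proof (rule blossom_eqI[OF inf P span])
    show "symmetric_multilinear r (\<lambda>ps. \<Sum>i\<le>N. C i * prod_list (map (L i) ps))"
      by (rule symmetric_multilinear_sum_prod_list) (rule lin)
    show "(\<Sum>i\<le>N. C i * prod_list (map (L i) (replicate r (\<gamma>1 x, \<gamma>2 x)))) =
        (gen_deriv \<gamma>1 \<gamma>2 I ^^ (n - 1)) G x" if "x \<in> I" for x
      using gen_deriv_funpow_sum_powers[OF G _ that, of "n - 1"] assms(8) that
      unfolding r by (simp add: L C_def)
  qed (use that in auto)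
  \<comment> \<open>The half-open form of \<open>{1..n}\<close> fits
    \<open>sum_sorted_lists_prod\<close>; it is converted back at the very end.\<close>
  let ?J = "{js. length js = r \<and> sorted js \<and> set js \<subseteq> {1..<n + 1}}"
  have "(\<Sum>js\<in>?J. blossom \<gamma>1 \<gamma>2 I r ((gen_deriv \<gamma>1 \<gamma>2 I ^^ (n - 1)) G)
         (map (\<lambda>j. (\<gamma>1 (\<epsilon> j), \<gamma>2 (\<epsilon> j))) js)) =
      (\<Sum>js\<in>?J. \<Sum>i\<le>N. C i * prod_list (map (\<lambda>j. 1 + real i * t (\<epsilon> j)) js))"
  proof (intro sum.cong refl)
    fix js assume js: "js \<in> ?J"
    then have "map (L i) (map (\<lambda>j. (\<gamma>1 (\<epsilon> j), \<gamma>2 (\<epsilon> j))) js) =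
        map (\<lambda>j. 1 + real i * t (\<epsilon> j)) js" for i
      using assms(10) by (auto intro!: L)
    then show "blossom \<gamma>1 \<gamma>2 I r ((gen_deriv \<gamma>1 \<gamma>2 I ^^ (n - 1)) G)
        (map (\<lambda>j. (\<gamma>1 (\<epsilon> j), \<gamma>2 (\<epsilon> j))) js) =
        (\<Sum>i\<le>N. C i * prod_list (map (\<lambda>j. 1 + real i * t (\<epsilon> j)) js))"
      using js by (subst blossom) (simp_all del: map_map)
  qed
  also have "\<dots> = (\<Sum>i\<le>N. C i * complete_homogeneous r (map (\<lambda>j. 1 + real i * t (\<epsilon> j)) [1..<n + 1]))"
    by (subst sum.swap) (simp add: sum_distrib_left[symmetric] sum_sorted_lists_prod del: upt_Suc)
  finally have sum: "(\<Sum>js\<in>?J. blossom \<gamma>1 \<gamma>2 I r ((gen_deriv \<gamma>1 \<gamma>2 I ^^ (n - 1)) G)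
         (map (\<lambda>j. (\<gamma>1 (\<epsilon> j), \<gamma>2 (\<epsilon> j))) js)) = \<dots>" .
  have "divdiff \<gamma>1 \<gamma>2 I G (map \<epsilon> [1..<n + 1]) = (\<Sum>i\<le>N. c i * real i ^ (n - 1) *
      complete_homogeneous r (map (\<lambda>j. 1 + real i * t (\<epsilon> j)) [1..<n + 1]))"
    using assms(7,8,10)
    by (subst divdiff_sum_powers[OF G]) (auto simp: r_def comp_def simp del: upt_Suc)
  \<comment> \<open>The prefactor of the claim cancels the quotient \<open>fact N / fact r\<close>
    contained in \<open>C i\<close>.\<close>
  also have "\<dots> = fact r / fact N *
      (\<Sum>i\<le>N. C i * complete_homogeneous r (map (\<lambda>j. 1 + real i * t (\<epsilon> j)) [1..<n + 1]))"
    unfolding sum_distrib_left by (intro sum.cong) (simp_all add: C_def del: upt_Suc)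
  finally show ?thesis
    unfolding sum[symmetric] by (simp add: r_def atLeastLessThanSuc_atLeastAtMost)
qed

end
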